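(* Let $G$ be a group, $U$ a set, and $f_G$ a soft int-group in $G$ over $U$, with normalizer $N(f_G)$. Then: (1) $N(f_G)$ is a subgroup of $G$; (2) the restriction $f_G|_{N(f_G)}$ of $f_G$ to $N(f_G)$ is a normal soft int-group in the group $N(f_G)$ over $U$; (3) $f_G$ is a normal soft int-group in $G$ if and only if $N(f_G)=G$.
   Context: Let $P(U)$ be the power set of $U$. For a group $K$, a soft int-group in $K$ over $U$ is a function $f_K:K\to P(U)$ such that $f_K(xy)\supseteq f_K(x)\cap f_K(y)$ and $f_K(x^{-1})=f_K(x)$ for all $x,y\in K$; it is a normal soft int-group in $K$ if moreover $f_K(xy)=f_K(yx)$ for all $x,y\in K$. The normalizer of a soft int-group $f_G$ in $G$ is $N(f_G)=\{x\in G: f_G(xy)=f_G(yx)\text{ for all }y\in G\}$. *)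

theory Defs
  imports "HOL-Algebra.Group" "HOL-Library.FuncSet"
begin

(* A map K \<rightarrow> P(U) is a HOL function of which only the values on carrier K matter;
   its values elsewhere are left unconstrained. *)

locale soft_int_group = group K for K (structure) +
  fixes U :: "'u set" and f :: "'a \<Rightarrow> 'u set"
  assumes soft_set: "f \<in> carrier K \<rightarrow> Pow U"
    and soft_mult: "\<lbrakk>x \<in> carrier K; y \<in> carrier K\<rbrakk> \<Longrightarrow> f (x \<otimes> y) \<supseteq> f x \<inter> f y"
    and soft_inv: "x \<in> carrier K \<Longrightarrow> f (inv x) = f x"

locale normal_soft_int_group = soft_int_group +
  assumes soft_comm: "\<lbrakk>x \<in> carrier K; y \<in> carrier K\<rbrakk> \<Longrightarrow> f (x \<otimes> y) = f (y \<otimes> x)"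

definition soft_normalizer :: "('a, 'b) monoid_scheme \<Rightarrow> ('a \<Rightarrow> 'u set) \<Rightarrow> 'a set" where
  "soft_normalizer G f =
    {x \<in> carrier G. \<forall>y \<in> carrier G. f (x \<otimes>\<^bsub>G\<^esub> y) = f (y \<otimes>\<^bsub>G\<^esub> x)}"

end

theory Submission
  imports Defs
begin

text \<open>An element lies in the normalizer exactly when \<open>f\<close> does not notice its
  being moved from one end of a product to the other. Two such elements can be moved one after the
  other, so their product can be moved as well; since \<open>f\<close> is invariant under inversion,
  the inverse of a movable element is movable. Hence the normalizer is a subgroup. A soft int-group
  restricts to any subgroup, and on the normalizer the defining condition, read for arguments inside
  it, is normality. Finally, the normalizer is everything iff that condition holds for all pairs,
  which is normality of \<open>f\<close>.\<close>

context soft_int_group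
begin

lemma soft_normalizer_commD:
  assumes "x \<in> soft_normalizer K f" "y \<in> carrier K"
  shows "f (x \<otimes> y) = f (y \<otimes> x)"
  using assms by (simp add: soft_normalizer_def)

lemma soft_normalizer_subset: "soft_normalizer K f \<subseteq> carrier K"
  by (auto simp: soft_normalizer_def)

text \<open>Two rotations: in \<open>a \<otimes> b \<otimes> y\<close> the leading \<open>a\<close>
  is carried to the end, then \<open>b\<close>, with reassociation in between.\<close>

lemma soft_normalizer_m_closed:
  assumes a: "a \<in> soft_normalizer K f" and b: "b \<in> soft_normalizer K f"
  shows "a \<otimes> b \<in> soft_normalizer K f"
proof -
  have ac: "a \<in> carrier K" and bc: "b \<in> carrier K"
    using a b soft_normalizer_subset by auto
  have "f (a \<otimes> b \<otimes> y) = f (y \<otimes> (a \<otimes> b))" if y: "y \<in> carrier K" for y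
  proof -
    have "f (a \<otimes> b \<otimes> y) = f (a \<otimes> (b \<otimes> y))"
      using ac bc y by (simp add: m_assoc)
    also have "\<dots> = f (b \<otimes> y \<otimes> a)"
      using a bc y by (intro soft_normalizer_commD) auto
    also have "\<dots> = f (b \<otimes> (y \<otimes> a))"
      using ac bc y by (simp add: m_assoc)
    also have "\<dots> = f (y \<otimes> a \<otimes> b)"
      using b ac y by (intro soft_normalizer_commD) auto
    also have "\<dots> = f (y \<otimes> (a \<otimes> b))"
      using ac bc y by (simp add: m_assoc)
    finally show ?thesis .
  qed
  then show ?thesis
    using ac bc by (simp add: soft_normalizer_def)
qed

text \<open>Inverting the whole argument of \<open>f\<close> replaces \<open>inv a\<close> by
  \<open>a\<close> and \<open>y\<close> by \<open>inv y\<close>; there \<open>a\<close> commutes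
  under \<open>f\<close>, and a second inversion restores the original factors.\<close>

lemma soft_normalizer_inv_closed:
  assumes a: "a \<in> soft_normalizer K f"
  shows "inv a \<in> soft_normalizer K f"
proof -
  have ac: "a \<in> carrier K"
    using a soft_normalizer_subset by auto
  have "f (inv a \<otimes> y) = f (y \<otimes> inv a)" if y: "y \<in> carrier K" for y
  proof -
    have "f (inv a \<otimes> y) = f (inv y \<otimes> a)"
      using soft_inv[of "inv a \<otimes> y"] ac y by (simp add: inv_mult_group)
    also have "\<dots> = f (a \<otimes> inv y)"
      using soft_normalizer_commD[OF a, of "inv y"] y by simp
    also have "\<dots> = f (y \<otimes> inv a)"
      using soft_inv[of "a \<otimes> inv y"] ac y by (simp add: inv_mult_group)
    finally show ?thesis .
  qed
  then show ?thesis
    using ac by (simp add: soft_normalizer_def)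
qed

lemma subgroup_soft_normalizer: "subgroup (soft_normalizer K f) K"
proof (rule subgroup.intro)
  show "\<one> \<in> soft_normalizer K f"
    by (simp add: soft_normalizer_def)
qed (simp_all add: soft_normalizer_subset soft_normalizer_m_closed soft_normalizer_inv_closed)

lemma soft_int_group_restrict:
  assumes H: "subgroup H K"
  shows "soft_int_group (K\<lparr>carrier := H\<rparr>) U (restrict f H)"
proof -
  interpret H: subgroup H K by (fact H)
  show ?thesis
  proof (intro soft_int_group.intro soft_int_group_axioms.intro)
    show "group (K\<lparr>carrier := H\<rparr>)"
      using H by (rule subgroup_imp_group)
    show "restrict f H \<in> carrier (K\<lparr>carrier := H\<rparr>) \<rightarrow> Pow U"
      using soft_set H.subset by auto
  next
    fix x y assume "x \<in> carrier (K\<lparr>carrier := H\<rparr>)" "y \<in> carrier (K\<lparr>carrier := H\<rparr>)"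
    then show "restrict f H x \<inter> restrict f H y \<subseteq> restrict f H (x \<otimes>\<^bsub>K\<lparr>carrier := H\<rparr>\<^esub> y)"
      using soft_mult[of x y] by simp
  next
    fix x assume "x \<in> carrier (K\<lparr>carrier := H\<rparr>)"
    \<comment> \<open>Inverses taken in the subgroup agree with those of \<open>K\<close>, so the
      symmetry of \<open>f\<close> carries over.\<close>
    then show "restrict f H (inv\<^bsub>K\<lparr>carrier := H\<rparr>\<^esub> x) = restrict f H x"
      using H by (simp add: m_inv_consistent soft_inv)
  qed
qed

lemma normal_soft_int_group_restrict_normalizer:
  "normal_soft_int_group (K\<lparr>carrier := soft_normalizer K f\<rparr>) U (restrict f (soft_normalizer K f))"
proof (intro normal_soft_int_group.intro normal_soft_int_group_axioms.intro)
  show "soft_int_group (K\<lparr>carrier := soft_normalizer K f\<rparr>) U (restrict f (soft_normalizer K f))"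
    using subgroup_soft_normalizer by (rule soft_int_group_restrict)
\<comment> \<open>Closure puts both products inside the normalizer, where the restriction equals
  \<open>f\<close>; what is left is the commuting condition.\<close>
qed (use soft_normalizer_subset in \<open>simp add: soft_normalizer_m_closed soft_normalizer_commD subset_iff\<close>)

lemma normal_soft_int_group_iff_soft_normalizer:
  "normal_soft_int_group K U f \<longleftrightarrow> soft_normalizer K f = carrier K"
  \<comment> \<open>This fact is the full predicate \<open>soft_int_group K U f\<close>, so
    normality reduces to its commutation clause.\<close>
  using soft_int_group_axioms
  by (auto simp: normal_soft_int_group_def normal_soft_int_group_axioms_def soft_normalizer_def)

end

theorem theorem3p28:
  fixes G :: "('a, 'b) monoid_scheme" and U :: "'u set" and f :: "'a \<Rightarrow> 'u set"
  assumes "group G" and "soft_int_group G U f"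
  shows "subgroup (soft_normalizer G f) G
    \<and> normal_soft_int_group (G\<lparr>carrier := soft_normalizer G f\<rparr>) U (restrict f (soft_normalizer G f))
    \<and> (normal_soft_int_group G U f \<longleftrightarrow> soft_normalizer G f = carrier G)"
proof -
  interpret soft_int_group G U f by (fact assms(2))
  show ?thesis
    using subgroup_soft_normalizer normal_soft_int_group_restrict_normalizer
      normal_soft_int_group_iff_soft_normalizer by blast
qed

end
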